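(* Let $\mathbb{F}$ be an algebraically closed field of characteristic not equal to $2$, let $V$ be a vector space over $\mathbb{F}$ of countably infinite dimension, let $f:V\to\mathbb{F}$ be a nondegenerate quadratic form, and let $v_i$, $i\in\mathbb{N}$, be an arbitrary orthonormal basis of $V$. (1) Any nonzero even derivation $D$ of $\mathcal{C}\ell(V,f)$ can be uniquely represented as a sum $$D=\sum_{S}\alpha_S\,\mathrm{ad}(v_S),\qquad 0\neq\alpha_S\in\mathbb{F},$$ where the subsets $S$ are (distinct) finite nonempty subsets of $\mathbb{N}$ of even order, and any $i\in\mathbb{N}$ lies in no more than finitely many of the subsets $S$. (2) Any nonzero odd derivation $D$ of $\mathcal{C}\ell(V,f)$ can be uniquely represented as a sum $$D=\sum_{S}\alpha_S\,\mathrm{ad}(v_S),\qquad 0\neq\alpha_S\in\mathbb{F},$$ where the subsets $S$ are (distinct) finite subsets of $\mathbb{N}$ of odd order, and any $i\in\mathbb{N}$ lies in all but finitely many of the subsets $S$.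
   Context: $\mathbb{N}$ is the set of positive integers. A quadratic form on $V$ is a map $f:V\to\mathbb{F}$ with $f(\lambda v)=\lambda^2 f(v)$ such that $f(v,w)=f(v+w)-f(v)-f(w)$ is bilinear; it is nondegenerate if the bilinear form $f(v,w)$ is nondegenerate. The Clifford algebra $\mathcal{C}\ell(V,f)$ is the unital associative $\mathbb{F}$-algebra generated by $V$ with defining relations $v^2=f(v)\cdot 1$, $v\in V$. It is $\mathbb{Z}/2\mathbb{Z}$-graded: $\mathcal{C}\ell(V,f)_{\overline{0}}$ is the span of $1$ and all products of an even number of elements of $V$, and $\mathcal{C}\ell(V,f)_{\overline{1}}$ is the span of all products of an odd number of elements of $V$. A basis $v_i$, $i\in\mathbb{N}$, is orthonormal if $v_iv_j+v_jv_i=2\delta_{ij}$ in $\mathcal{C}\ell(V,f)$ for all $i,j$. For a finite set $S=\{i_1<\cdots<i_r\}\subset\mathbb{N}$, $v_S=v_{i_1}\cdots v_{i_r}$. A derivation means an ordinary ($\mathbb{F}$-linear, ungraded Leibniz rule) derivation. A derivation $D$ is even if $D(\mathcal{C}\ell(V,f)_{\overline{0}})\subseteq\mathcal{C}\ell(V,f)_{\overline{0}}$ and $D(\mathcal{C}\ell(V,f)_{\overline{1}})\subseteq\mathcal{C}\ell(V,f)_{\overline{1}}$; it is odd if $D(\mathcal{C}\ell(V,f)_{\overline{0}})\subseteq\mathcal{C}\ell(V,f)_{\overline{1}}$ and $D(\mathcal{C}\ell(V,f)_{\overline{1}})\subseteq\mathcal{C}\ell(V,f)_{\overline{0}}$.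 $\mathrm{ad}(a)$ is the inner derivation $x\mapsto [a,x]=ax-xa$. The sums may be infinite and are understood pointwise: for every $a\in\mathcal{C}\ell(V,f)$ only finitely many terms $\mathrm{ad}(v_S)(a)$ are nonzero, and $D(a)$ is the sum of these. Uniqueness means that the family of subsets $S$ and the coefficients $\alpha_S$ are determined by $D$. *)

theory Defs
  imports
    "HOL-Computational_Algebra.Polynomial"
    "HOL-Library.Poly_Mapping"
begin

section \<open>Quadratic forms\<close>

definition polar_form :: "('v::ab_group_add \<Rightarrow> 'f::field) \<Rightarrow> 'v \<Rightarrow> 'v \<Rightarrow> 'f" where
  "polar_form f v w = f (v + w) - f v - f w"

definition quadratic_form :: "('f::field \<Rightarrow> 'v::ab_group_add \<Rightarrow> 'v) \<Rightarrow> ('v \<Rightarrow> 'f) \<Rightarrow> bool" where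
  "quadratic_form scaleV f \<longleftrightarrow>
     (\<forall>c v. f (scaleV c v) = c\<^sup>2 * f v) \<and>
     (\<forall>w. Vector_Spaces.linear scaleV (*) (\<lambda>v. polar_form f v w)) \<and>
     (\<forall>v. Vector_Spaces.linear scaleV (*) (\<lambda>w. polar_form f v w))"

definition nondegenerate :: "('v::ab_group_add \<Rightarrow> 'f::field) \<Rightarrow> bool" where
  "nondegenerate f \<longleftrightarrow> (\<forall>v. (\<forall>w. polar_form f v w = 0) \<longrightarrow> v = 0)"

text \<open>The first argument is the family of basis vectors, the second one the index set.\<close>

definition is_basis ::
    "('f::field \<Rightarrow> 'v::ab_group_add \<Rightarrow> 'v) \<Rightarrow> ('i \<Rightarrow> 'v) \<Rightarrow> 'i set \<Rightarrow> bool" where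
  "is_basis scaleV v I \<longleftrightarrow>
     inj_on v I \<and> \<not> module.dependent scaleV (v ` I) \<and> module.span scaleV (v ` I) = UNIV"

definition countably_infinite_dimensional ::
    "('f::field \<Rightarrow> 'v::ab_group_add \<Rightarrow> 'v) \<Rightarrow> bool" where
  "countably_infinite_dimensional scaleV \<longleftrightarrow>
     (\<exists>B. \<not> module.dependent scaleV B \<and> module.span scaleV B = UNIV \<and>
          infinite B \<and> (\<exists>e :: 'v \<Rightarrow> nat. inj_on e B))"


section \<open>Associative algebras and the free algebra\<close>

locale assoc_algebra = vector_space scaleA
  for scaleA :: "'f::field \<Rightarrow> 'a::ring_1 \<Rightarrow> 'a" +
  assumes scale_mult_left: "scaleA c x * y = scaleA c (x * y)"
    and scale_mult_right: "x * scaleA c y = scaleA c (x * y)"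

text \<open>
  With concatenation as addition, lists form the free monoid, so that the convolution
  product makes the finitely supported functions \<open>'x list \<Rightarrow>\<^sub>0 'f\<close> into the free
  associative unital algebra on the set of all elements of type \<open>'x\<close>.
\<close>

instantiation list :: (type) monoid_add
begin

definition zero_list_def: "0 = []"

definition plus_list_def: "xs + ys = xs @ ys"

instance
  by standard (simp_all add: zero_list_def plus_list_def)

end

type_synonym ('x, 'f) free_algebra = "'x list \<Rightarrow>\<^sub>0 'f"

definition free_const :: "'f::field \<Rightarrow> ('x, 'f) free_algebra" where
  "free_const c = Poly_Mapping.single [] c"

definition free_gen :: "'x \<Rightarrow> ('x, 'f::field) free_algebra" where
  "free_gen x = Poly_Mapping.single [x] 1"

definition free_eval ::
    "('f::field \<Rightarrow> 'a::ring_1 \<Rightarrow> 'a) \<Rightarrow> ('x \<Rightarrow> 'a) \<Rightarrow> ('x, 'f) free_algebra \<Rightarrow> 'a" where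
  "free_eval scaleA g p =
     (\<Sum>w\<in>Poly_Mapping.keys p. scaleA (Poly_Mapping.lookup p w) (prod_list (map g w)))"

context assoc_algebra
begin

lemma free_eval_superset:
  assumes "finite A" "Poly_Mapping.keys p \<subseteq> A"
  shows "free_eval scaleA g p =
    (\<Sum>w\<in>A. scaleA (Poly_Mapping.lookup p w) (prod_list (map g w)))"
  unfolding free_eval_def using assms
  by (intro sum.mono_neutral_left) (auto simp: in_keys_iff)

lemma free_eval_single:
  "free_eval scaleA g (Poly_Mapping.single w c) = scaleA c (prod_list (map g w))"
  by (subst free_eval_superset[of "{w}"]) auto

lemma free_eval_const: "free_eval scaleA g (free_const c) = scaleA c 1"
  by (simp add: free_const_def free_eval_single)

lemma free_eval_gen: "free_eval scaleA g (free_gen x) = g x"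
  by (simp add: free_gen_def free_eval_single)

lemma free_eval_add: "free_eval scaleA g (p + q) = free_eval scaleA g p + free_eval scaleA g q"
proof -
  let ?A = "Poly_Mapping.keys p \<union> Poly_Mapping.keys q"
  have "Poly_Mapping.keys (p + q) \<subseteq> ?A"
    by (rule Poly_Mapping.keys_add)
  then show ?thesis
    by (simp add: free_eval_superset[of ?A] lookup_add scale_left_distrib sum.distrib)
qed

lemma free_eval_uminus: "free_eval scaleA g (- p) = - free_eval scaleA g p"
  using free_eval_add[of g p "- p"] by (simp add: free_eval_def add_eq_0_iff)

lemma free_eval_diff: "free_eval scaleA g (p - q) = free_eval scaleA g p - free_eval scaleA g q"
  using free_eval_add[of g p "- q"] by (simp add: free_eval_uminus)

lemma free_eval_sum: "free_eval scaleA g (\<Sum>i\<in>A. h i) = (\<Sum>i\<in>A. free_eval scaleA g (h i))"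
proof (induction A rule: infinite_finite_induct)
qed (simp_all add: free_eval_add, simp_all add: free_eval_def)

lemma free_eval_mult: "free_eval scaleA g (p * q) = free_eval scaleA g p * free_eval scaleA g q"
proof -
  have *: "r = (\<Sum>w\<in>Poly_Mapping.keys r. Poly_Mapping.single w (Poly_Mapping.lookup r w))"
    for r :: "('c, 'f) free_algebra"
    by (rule poly_mapping_eqI) (auto simp: lookup_sum lookup_single when_def in_keys_iff)
  have "free_eval scaleA g (p * q) =
    (\<Sum>w\<in>Poly_Mapping.keys p. \<Sum>u\<in>Poly_Mapping.keys q.
       free_eval scaleA g (Poly_Mapping.single (w + u)
         (Poly_Mapping.lookup p w * Poly_Mapping.lookup q u)))"
    by (subst *[of p], subst *[of q])
       (simp add: sum_distrib_left sum_distrib_right free_eval_sum mult_single sum.swap[of _ "Poly_Mapping.keys q"])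
  also have "\<dots> = (\<Sum>w\<in>Poly_Mapping.keys p. \<Sum>u\<in>Poly_Mapping.keys q.
      scaleA (Poly_Mapping.lookup p w) (prod_list (map g w)) *
      scaleA (Poly_Mapping.lookup q u) (prod_list (map g u)))"
    by (simp only: free_eval_single plus_list_def map_append prod_list.append scale_mult_left
        scale_mult_right scale_scale mult.commute)
  also have "\<dots> = free_eval scaleA g p * free_eval scaleA g q"
    by (simp only: free_eval_def sum_product)
  finally show ?thesis .
qed

end

definition two_sided_ideal :: "'a::ring_1 set \<Rightarrow> bool" where
  "two_sided_ideal I \<longleftrightarrow>
     0 \<in> I \<and> (\<forall>x\<in>I. \<forall>y\<in>I. x + y \<in> I) \<and> (\<forall>r. \<forall>x\<in>I. r * x \<in> I \<and> x * r \<in> I)"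

definition ideal_generated :: "'a::ring_1 set \<Rightarrow> 'a set" where
  "ideal_generated R = \<Inter>{I. two_sided_ideal I \<and> R \<subseteq> I}"


section \<open>Clifford algebras\<close>

text \<open>
  The first two families of relations express that the generators form the vector space
  \<open>V\<close> and not just a set.
\<close>

definition clifford_relations ::
    "('f::field \<Rightarrow> 'v::ab_group_add \<Rightarrow> 'v) \<Rightarrow> ('v \<Rightarrow> 'f) \<Rightarrow> ('v, 'f) free_algebra set" where
  "clifford_relations scaleV f =
     {free_gen (v + w) - (free_gen v + free_gen w) | v w. True} \<union>
     {free_gen (scaleV c v) - free_const c * free_gen v | c v. True} \<union>
     {free_gen v * free_gen v - free_const (f v) | v. True}"

lemma clifford_relationsI:
  "free_gen (v + w) - (free_gen v + free_gen w) \<in> clifford_relations scaleV f"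
  "free_gen (scaleV c v) - free_const c * free_gen v \<in> clifford_relations scaleV f"
  "free_gen v * free_gen v - free_const (f v) \<in> clifford_relations scaleV f"
  unfolding clifford_relations_def by blast+

text \<open>
  An algebra \<open>'a\<close> with a map \<open>\<iota>\<close> from \<open>V\<close> is a Clifford algebra of \<open>(V, f)\<close> if it is
  presented by the generators \<open>\<iota> v\<close> and the relations above, i.e. if evaluation
  identifies it with the free algebra modulo the ideal generated by the relations.
\<close>

locale clifford_algebra = V: vector_space scaleV + A: assoc_algebra scaleA
  for scaleV :: "'f::field \<Rightarrow> 'v::ab_group_add \<Rightarrow> 'v"
    and scaleA :: "'f \<Rightarrow> 'a::ring_1 \<Rightarrow> 'a" +
  fixes f :: "'v \<Rightarrow> 'f" and \<iota> :: "'v \<Rightarrow> 'a"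
  assumes quadratic_form: "quadratic_form scaleV f"
    and generated: "surj (free_eval scaleA \<iota>)"
    and presented: "free_eval scaleA \<iota> p = 0 \<longleftrightarrow> p \<in> ideal_generated (clifford_relations scaleV f)"

context clifford_algebra
begin

lemma relation_eval: "r \<in> clifford_relations scaleV f \<Longrightarrow> free_eval scaleA \<iota> r = 0"
  by (auto simp: presented ideal_generated_def)

lemma linear_iota: "Vector_Spaces.linear scaleV scaleA \<iota>"
proof -
  have "\<iota> (v + w) = \<iota> v + \<iota> w" for v w
    using relation_eval[OF clifford_relationsI(1)[where v = v and w = w]]
    by (simp add: A.free_eval_diff A.free_eval_add A.free_eval_gen)
  moreover have "\<iota> (scaleV c v) = scaleA c (\<iota> v)" for c v
    using relation_eval[OF clifford_relationsI(2)[where c = c and v = v]]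
    by (simp add: A.free_eval_diff A.free_eval_mult A.free_eval_gen
        A.free_eval_const A.scale_mult_left)
  ultimately show ?thesis
    by (simp add: Vector_Spaces.linear_def module_hom_def module_hom_axioms_def
        V.module_axioms A.module_axioms V.vector_space_axioms A.vector_space_axioms)
qed

lemma iota_square: "\<iota> v * \<iota> v = scaleA (f v) 1"
  using relation_eval[OF clifford_relationsI(3)[where v = v]]
  by (simp add: A.free_eval_diff A.free_eval_mult A.free_eval_gen
      A.free_eval_const)

lemma universal_property:
  fixes scaleB :: "'f \<Rightarrow> 'b::ring_1 \<Rightarrow> 'b" and j :: "'v \<Rightarrow> 'b"
  assumes "assoc_algebra scaleB"
    and j: "Vector_Spaces.linear scaleV scaleB j" "\<And>v. j v * j v = scaleB (f v) 1"
  shows "\<exists>!h. Vector_Spaces.linear scaleA scaleB h \<and> h 1 = 1 \<and>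
              (\<forall>x y. h (x * y) = h x * h y) \<and> (\<forall>v. h (\<iota> v) = j v)"
proof -
  interpret B: assoc_algebra scaleB by fact
  interpret j: Vector_Spaces.linear scaleV scaleB j by fact
  let ?E = "free_eval scaleA \<iota>" and ?F = "free_eval scaleB j"
  have F0: "?F p = 0" if "?E p = 0" for p
  proof -
    have "two_sided_ideal {p. ?F p = 0}"
      by (auto simp: two_sided_ideal_def B.free_eval_add B.free_eval_mult)
         (simp add: free_eval_def)
    moreover have "clifford_relations scaleV f \<subseteq> {p. ?F p = 0}"
      by (auto simp: clifford_relations_def B.free_eval_diff B.free_eval_add B.free_eval_mult
          B.free_eval_gen B.free_eval_const B.scale_mult_left j j.add j.scale)
    moreover have "p \<in> ideal_generated (clifford_relations scaleV f)"
      using that presented by blast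
    ultimately show ?thesis by (auto simp: ideal_generated_def)
  qed
  define h where "h x = ?F (SOME p. ?E p = x)" for x
  have h: "h (?E p) = ?F p" for p
  proof -
    have "?E (SOME q. ?E q = ?E p) = ?E p" by (rule someI) simp
    then have "?F ((SOME q. ?E q = ?E p) - p) = 0" by (intro F0) (simp add: A.free_eval_diff)
    then show ?thesis by (simp add: h_def B.free_eval_diff)
  qed
  have ex: "\<exists>p. x = ?E p" for x using generated by (meson surjD)
  have add: "h (x + y) = h x + h y" for x y
    using ex[of x] ex[of y] by (auto simp: h B.free_eval_add simp flip: A.free_eval_add)
  have mult: "h (x * y) = h x * h y" for x y
    using ex[of x] ex[of y] by (auto simp: h B.free_eval_mult simp flip: A.free_eval_mult)
  have const: "h (scaleA c 1) = scaleB c 1" for c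
    using h[of "free_const c"] by (simp add: A.free_eval_const B.free_eval_const)
  have scale: "h (scaleA c x) = scaleB c (h x)" for c x
    using mult[of "scaleA c 1" x] by (simp add: const A.scale_mult_left B.scale_mult_left)
  have lin: "Vector_Spaces.linear scaleA scaleB h"
    by (simp add: Vector_Spaces.linear_def module_hom_def module_hom_axioms_def add scale
        B.module_axioms A.module_axioms B.vector_space_axioms A.vector_space_axioms)
  have one: "h 1 = 1" using const[of 1] by simp
  have gen: "h (\<iota> v) = j v" for v
    using h[of "free_gen v"] by (simp add: A.free_eval_gen B.free_eval_gen)
  show ?thesis
  proof (intro ex1I[of _ h] conjI allI)
    fix k
    assume k: "Vector_Spaces.linear scaleA scaleB k \<and> k 1 = 1 \<and>
      (\<forall>x y. k (x * y) = k x * k y) \<and> (\<forall>v. k (\<iota> v) = j v)"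
    then interpret k: Vector_Spaces.linear scaleA scaleB k by simp
    have "k (prod_list (map \<iota> w)) = prod_list (map j w)" for w
      using k by (induction w) auto
    then have "k (?E p) = ?F p" for p
      by (simp add: free_eval_def k.sum k.scale)
    then show "k = h" using ex h by (metis ext)
  qed (fact lin one mult gen)+
qed

end

definition clifford_even ::
    "('f::field \<Rightarrow> 'a::ring_1 \<Rightarrow> 'a) \<Rightarrow> ('v \<Rightarrow> 'a) \<Rightarrow> 'a set" where
  "clifford_even scaleA \<iota> =
     module.span scaleA (insert 1 {prod_list (map \<iota> w) | w. even (length w)})"

definition clifford_odd ::
    "('f::field \<Rightarrow> 'a::ring_1 \<Rightarrow> 'a) \<Rightarrow> ('v \<Rightarrow> 'a) \<Rightarrow> 'a set" where
  "clifford_odd scaleA \<iota> = module.span scaleA {prod_list (map \<iota> w) | w. odd (length w)}"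

text \<open>Here \<open>\<nat>\<close> is the set \<open>{1..}\<close> of positive integers; the value \<open>v 0\<close> is irrelevant.\<close>

definition orthonormal_basis ::
    "('f::field \<Rightarrow> 'v::ab_group_add \<Rightarrow> 'v) \<Rightarrow> ('v \<Rightarrow> 'a::ring_1) \<Rightarrow> (nat \<Rightarrow> 'v) \<Rightarrow> bool" where
  "orthonormal_basis scaleV \<iota> v \<longleftrightarrow>
     is_basis scaleV v {1..} \<and>
     (\<forall>i\<ge>1. \<forall>j\<ge>1. \<iota> (v i) * \<iota> (v j) + \<iota> (v j) * \<iota> (v i) = (if i = j then 2 else 0))"

definition basis_product :: "('v \<Rightarrow> 'a::ring_1) \<Rightarrow> (nat \<Rightarrow> 'v) \<Rightarrow> nat set \<Rightarrow> 'a" where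
  "basis_product \<iota> v S = prod_list (map (\<lambda>i. \<iota> (v i)) (sorted_list_of_set S))"


section \<open>Derivations\<close>

definition derivation :: "('f::field \<Rightarrow> 'a::ring_1 \<Rightarrow> 'a) \<Rightarrow> ('a \<Rightarrow> 'a) \<Rightarrow> bool" where
  "derivation scaleA D \<longleftrightarrow>
     Vector_Spaces.linear scaleA scaleA D \<and> (\<forall>x y. D (x * y) = D x * y + x * D y)"

definition even_map ::
    "('f::field \<Rightarrow> 'a::ring_1 \<Rightarrow> 'a) \<Rightarrow> ('v \<Rightarrow> 'a) \<Rightarrow> ('a \<Rightarrow> 'a) \<Rightarrow> bool" where
  "even_map scaleA \<iota> D \<longleftrightarrow>
     D ` clifford_even scaleA \<iota> \<subseteq> clifford_even scaleA \<iota> \<and>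
     D ` clifford_odd scaleA \<iota> \<subseteq> clifford_odd scaleA \<iota>"

definition odd_map ::
    "('f::field \<Rightarrow> 'a::ring_1 \<Rightarrow> 'a) \<Rightarrow> ('v \<Rightarrow> 'a) \<Rightarrow> ('a \<Rightarrow> 'a) \<Rightarrow> bool" where
  "odd_map scaleA \<iota> D \<longleftrightarrow>
     D ` clifford_even scaleA \<iota> \<subseteq> clifford_odd scaleA \<iota> \<and>
     D ` clifford_odd scaleA \<iota> \<subseteq> clifford_even scaleA \<iota>"

definition ad :: "'a::ring_1 \<Rightarrow> 'a \<Rightarrow> 'a" where
  "ad a x = a * x - x * a"

text \<open>\<open>D = (\<Sum>S\<in>\<S>. \<alpha> S ad (u S))\<close> as a pointwise finite sum\<close>

definition is_ad_sum ::
    "('f::field \<Rightarrow> 'a::ring_1 \<Rightarrow> 'a) \<Rightarrow> ('s \<Rightarrow> 'a) \<Rightarrow> 's set \<Rightarrow> ('s \<Rightarrow> 'f) \<Rightarrow> ('a \<Rightarrow> 'a) \<Rightarrow> bool" where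
  "is_ad_sum scaleA u \<S> \<alpha> D \<longleftrightarrow>
     (\<forall>a. finite {S\<in>\<S>. ad (u S) a \<noteq> 0} \<and>
          D a = (\<Sum>S\<in>{S\<in>\<S>. ad (u S) a \<noteq> 0}. scaleA (\<alpha> S) (ad (u S) a)))"

text \<open>
  In the following two definitions \<open>\<alpha> S = 0\<close> means that \<open>S\<close> does not occur in the sum.
  Hence \<open>\<alpha>\<close> encodes both the family \<open>{S. \<alpha> S \<noteq> 0}\<close> of subsets and the nonzero coefficients,
  and uniqueness of \<open>\<alpha>\<close> is uniqueness of both.
\<close>

definition even_ad_representation ::
    "('f::field \<Rightarrow> 'a::ring_1 \<Rightarrow> 'a) \<Rightarrow> ('v \<Rightarrow> 'a) \<Rightarrow> (nat \<Rightarrow> 'v) \<Rightarrow> ('a \<Rightarrow> 'a) \<Rightarrow>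
     (nat set \<Rightarrow> 'f) \<Rightarrow> bool" where
  "even_ad_representation scaleA \<iota> v D \<alpha> \<longleftrightarrow>
     (let \<S> = {S. \<alpha> S \<noteq> 0} in
        (\<forall>S\<in>\<S>. S \<subseteq> {1..} \<and> finite S \<and> S \<noteq> {} \<and> even (card S)) \<and>
        (\<forall>i\<ge>1. finite {S\<in>\<S>. i \<in> S}) \<and>
        is_ad_sum scaleA (basis_product \<iota> v) \<S> \<alpha> D)"

definition odd_ad_representation ::
    "('f::field \<Rightarrow> 'a::ring_1 \<Rightarrow> 'a) \<Rightarrow> ('v \<Rightarrow> 'a) \<Rightarrow> (nat \<Rightarrow> 'v) \<Rightarrow> ('a \<Rightarrow> 'a) \<Rightarrow>
     (nat set \<Rightarrow> 'f) \<Rightarrow> bool" where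
  "odd_ad_representation scaleA \<iota> v D \<alpha> \<longleftrightarrow>
     (let \<S> = {S. \<alpha> S \<noteq> 0} in
        (\<forall>S\<in>\<S>. S \<subseteq> {1..} \<and> finite S \<and> odd (card S)) \<and>
        (\<forall>i\<ge>1. finite {S\<in>\<S>. i \<notin> S}) \<and>
        is_ad_sum scaleA (basis_product \<iota> v) \<S> \<alpha> D)"

end

theory Submission
  imports Defs
begin

text \<open>
  Write \<open>e\<^sub>i\<close> for the image of the basis vector \<open>v\<^sub>i\<close> in the algebra, so that the \<open>e\<^sub>i\<close> square
  to \<open>1\<close> and anticommute pairwise. Everything rests on the fact that conjugation by \<open>e\<^sub>i\<close> multiplies
  each monomial \<open>v\<^sub>S\<close> by a sign \<open>\<chi>\<^sub>i(S)\<close> (lemma \<open>conj_monomial\<close>): it is \<open>- 1\<close> for \<open>i \<in> S\<close> if \<open>S\<close> has even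
  order, and for \<open>i \<notin> S\<close> if \<open>S\<close> has odd order. As there are infinitely many generators, any two
  monomials are told apart by one of these signs (lemma \<open>finsets_separated\<close>). The monomials are
  therefore simultaneous eigenvectors with different systems of eigenvalues, hence linearly
  independent as soon as the algebra is nonzero; they form a basis because left multiplication by
  a generator permutes them up to sign. Let \<open>c\<^sub>S\<close> be the coordinate functionals of this basis.

  Given a derivation \<open>D\<close>, consider \<open>x\<^sub>i = D(e\<^sub>i) e\<^sub>i\<close>. If \<open>D = \<Sum>\<^sub>S \<alpha>\<^sub>S ad(v\<^sub>S)\<close>, then
  \<open>c\<^sub>S(x\<^sub>i) = 2 \<alpha>\<^sub>S\<close> whenever \<open>\<chi>\<^sub>i(S) = - 1\<close>. Every nonempty \<open>S\<close> has such an \<open>i\<close>, so the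
  coefficients are unique. Conversely, one defines \<open>\<alpha>\<^sub>S = c\<^sub>S(x\<^sub>i)/2\<close> for any such \<open>i\<close>. Applying
  \<open>D\<close> to \<open>e\<^sub>i e\<^sub>j + e\<^sub>j e\<^sub>i = 0\<close> gives \<open>(1 - \<chi>\<^sub>j(S)) c\<^sub>S(x\<^sub>i) = (1 - \<chi>\<^sub>i(S)) c\<^sub>S(x\<^sub>j)\<close>, so the choice
  of \<open>i\<close> does not matter (lemma \<open>derivation_coeff\<close>), and applying it to \<open>e\<^sub>i e\<^sub>i = 1\<close> shows that only
  those \<open>S\<close> with \<open>\<chi>\<^sub>i(S) = - 1\<close> contribute to \<open>x\<^sub>i\<close> (lemma \<open>derivation_coeff_commuting\<close>). Hence
  the sum takes the value \<open>D(e\<^sub>i)\<close> at each generator, with finitely many nonzero terms. Since \<open>D\<close>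
  and the sum both obey the Leibniz rule, this extends to the whole algebra
  (lemma \<open>is_ad_sum_if_on_generators\<close>).

  If \<open>D\<close> is even or odd, the elements \<open>x\<^sub>i\<close> have the same parity as \<open>D\<close>, and so do all \<open>S\<close> that
  occur. The conditions on how often an index occurs in the sets \<open>S\<close> say that \<open>\<chi>\<^sub>i(S) = - 1\<close> for only
  finitely many of them, which is the finiteness of the sum at \<open>e\<^sub>i\<close>.
\<close>

section \<open>Pointwise finite sums of inner derivations\<close>

context assoc_algebra
begin

lemma ad_1: "ad a (1::'b) = 0" for a :: "'b::ring_1"
  by (simp add: ad_def)

lemma ad_add: "ad a (x + y) = ad a x + ad a y" for a :: "'b::ring_1"
  by (simp add: ad_def algebra_simps)

lemma ad_mult: "ad a (x * y) = ad a x * y + x * ad a y" for a :: "'b::ring_1"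
  by (simp add: ad_def algebra_simps)

lemma ad_scale: "ad a (scaleA c x) = scaleA c (ad a x)"
  by (simp add: ad_def scale_mult_left scale_mult_right scale_right_diff_distrib)

text \<open>
  The elements at which the sum is finite and agrees with \<open>D\<close> form a subalgebra: by the Leibniz
  rule, a term that is nonzero at \<open>x * y\<close> is nonzero at \<open>x\<close> or at \<open>y\<close>.
\<close>

lemma is_ad_sum_if_on_generators:
  fixes u :: "'s \<Rightarrow> 'a" and X :: "'a set"
  assumes D: "derivation scaleA D"
    and gen: "span {prod_list xs | xs. set xs \<subseteq> span X} = UNIV"
    and fin: "\<And>a. a \<in> X \<Longrightarrow> finite {S\<in>\<S>. ad (u S) a \<noteq> 0}"
    and eq: "\<And>a. a \<in> X \<Longrightarrow> D a = (\<Sum>S\<in>{S\<in>\<S>. ad (u S) a \<noteq> 0}. scaleA (\<alpha> S) (ad (u S) a))"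
  shows "is_ad_sum scaleA u \<S> \<alpha> D"
proof -
  interpret D: Vector_Spaces.linear scaleA scaleA D
    using D by (simp add: derivation_def)
  have Dmult: "D (x * y) = D x * y + x * D y" for x y
    using D by (simp add: derivation_def)
  define supp where "supp a = {S\<in>\<S>. ad (u S) a \<noteq> 0}" for a
  define G where "G = {a. finite (supp a) \<and> D a = (\<Sum>S\<in>supp a. scaleA (\<alpha> S) (ad (u S) a))}"
  \<comment> \<open>Membership may be tested with any finite set of indices large enough to contain all
    nonzero terms, which allows sums over different supports to be merged.\<close>
  have eqG: "D a = (\<Sum>S\<in>F. scaleA (\<alpha> S) (ad (u S) a))"
    if "a \<in> G" "finite F" "supp a \<subseteq> F" "F \<subseteq> \<S>" for a F
  proof -
    have "(\<Sum>S\<in>supp a. scaleA (\<alpha> S) (ad (u S) a)) = (\<Sum>S\<in>F. scaleA (\<alpha> S) (ad (u S) a))"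
      using that by (intro sum.mono_neutral_left) (auto simp: supp_def)
    then show ?thesis using that by (simp add: G_def)
  qed
  have GI: "a \<in> G"
    if "D a = (\<Sum>S\<in>F. scaleA (\<alpha> S) (ad (u S) a))" "finite F" "supp a \<subseteq> F" "F \<subseteq> \<S>" for a F
  proof -
    have "(\<Sum>S\<in>supp a. scaleA (\<alpha> S) (ad (u S) a)) = (\<Sum>S\<in>F. scaleA (\<alpha> S) (ad (u S) a))"
      using that by (intro sum.mono_neutral_left) (auto simp: supp_def)
    then show ?thesis using that by (auto simp: G_def intro: finite_subset)
  qed
  have finG: "finite (supp a)" if "a \<in> G" for a using that by (simp add: G_def)
  have suppS: "supp a \<subseteq> \<S>" for a by (auto simp: supp_def)
  have "D 1 = 0" using Dmult[of 1 1] by simp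
  then have one: "1 \<in> G" by (simp add: G_def supp_def ad_1)
  have mult: "x * y \<in> G" if "x \<in> G" "y \<in> G" for x y
  proof (rule GI[where F = "supp x \<union> supp y"])
    have F: "finite (supp x \<union> supp y)" "supp x \<union> supp y \<subseteq> \<S>" using that finG suppS by auto
    show "D (x * y) = (\<Sum>S\<in>supp x \<union> supp y. scaleA (\<alpha> S) (ad (u S) (x * y)))"
      unfolding Dmult eqG[OF that(1) F(1) Un_upper1 F(2)] eqG[OF that(2) F(1) Un_upper2 F(2)]
      by (simp add: ad_mult sum_distrib_left sum_distrib_right scale_mult_left scale_mult_right
          scale_right_distrib sum.distrib)
    show "supp (x * y) \<subseteq> supp x \<union> supp y" by (auto simp: supp_def ad_mult)
  qed (use that finG suppS in auto)
  have "subspace G"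
  proof (rule subspaceI)
    show "0 \<in> G" by (simp add: G_def supp_def ad_def)
    show "x + y \<in> G" if "x \<in> G" "y \<in> G" for x y
    proof (rule GI[where F = "supp x \<union> supp y"])
      have F: "finite (supp x \<union> supp y)" "supp x \<union> supp y \<subseteq> \<S>" using that finG suppS by auto
      show "D (x + y) = (\<Sum>S\<in>supp x \<union> supp y. scaleA (\<alpha> S) (ad (u S) (x + y)))"
        unfolding D.add eqG[OF that(1) F(1) Un_upper1 F(2)] eqG[OF that(2) F(1) Un_upper2 F(2)]
        by (simp add: ad_add scale_right_distrib sum.distrib)
      show "supp (x + y) \<subseteq> supp x \<union> supp y" by (auto simp: supp_def ad_add)
    qed (use that finG suppS in auto)
    show "scaleA c x \<in> G" if "x \<in> G" for c x
    proof (rule GI[where F = "supp x"])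
      show "D (scaleA c x) = (\<Sum>S\<in>supp x. scaleA (\<alpha> S) (ad (u S) (scaleA c x)))"
        using that by (simp add: G_def D.scale scale_sum_right ad_scale mult.commute)
      show "supp (scaleA c x) \<subseteq> supp x" by (auto simp: supp_def ad_scale)
    qed (use that finG suppS in auto)
  qed
  have "span X \<subseteq> G"
    using fin eq by (intro span_minimal \<open>subspace G\<close>) (auto simp: G_def supp_def)
  then have "prod_list xs \<in> G" if "set xs \<subseteq> span X" for xs
    using that by (induction xs) (auto simp: one mult)
  then have "span {prod_list xs | xs. set xs \<subseteq> span X} \<subseteq> G"
    by (intro span_minimal \<open>subspace G\<close>) auto
  then have "G = UNIV" using gen by (simp add: top.extremum_unique)
  then show ?thesis by (auto simp: is_ad_sum_def G_def supp_def)
qed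

end

section \<open>Monomials in anticommuting involutions\<close>

text \<open>
  The image of an orthonormal basis in a Clifford algebra, without reference to a quadratic form.
  Indices come from a subset of an ordered type, so that the positive integers can serve as indices
  of type \<open>nat\<close>; the order fixes the arrangement of the factors of a monomial.
\<close>

locale clifford_generators = assoc_algebra scaleA
  for scaleA :: "'f::field \<Rightarrow> 'a::ring_1 \<Rightarrow> 'a" +
  fixes e :: "'i::linorder \<Rightarrow> 'a" and I :: "'i set"
  assumes infinite_I: "infinite I"
    and two_nonzero: "(2::'f) \<noteq> 0"
    and square: "i \<in> I \<Longrightarrow> e i * e i = 1"
    and anticommute: "i \<in> I \<Longrightarrow> j \<in> I \<Longrightarrow> i \<noteq> j \<Longrightarrow> e i * e j = - (e j * e i)"
    and generated: "span {prod_list xs | xs. set xs \<subseteq> span (e ` I)} = UNIV"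
begin

definition monomial :: "'i set \<Rightarrow> 'a" where
  "monomial S = prod_list (map e (sorted_list_of_set S))"

text \<open>
  Moving \<open>e i\<close> past the monomial of \<open>S\<close> produces one sign for each element of \<open>S\<close> other than \<open>i\<close>;
  their number is odd precisely under the following condition.
\<close>

definition anticommutes :: "'i \<Rightarrow> 'i set \<Rightarrow> bool" where
  "anticommutes i S \<longleftrightarrow> (even (card S) \<longleftrightarrow> i \<in> S)"

definition flip :: "'i \<Rightarrow> 'i set \<Rightarrow> 'i set" where
  "flip i S = (if i \<in> S then S - {i} else insert i S)"

abbreviation finsets :: "'i set set" where
  "finsets \<equiv> {S. finite S \<and> S \<subseteq> I}"

abbreviation sign :: "'i \<Rightarrow> 'i set \<Rightarrow> 'f" where
  "sign i S \<equiv> (if anticommutes i S then - 1 else 1)"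

lemma monomial_empty: "monomial {} = 1"
  by (simp add: monomial_def)

lemma monomial_insert_min:
  assumes "finite S" "\<forall>j\<in>S. i < j"
  shows "monomial (insert i S) = e i * monomial S"
proof -
  have "i \<notin> S" using assms by auto
  then have "sorted_list_of_set (insert i S) = i # sorted_list_of_set S"
    using assms by (simp add: insort_is_Cons less_imp_le)
  then show ?thesis by (simp add: monomial_def)
qed

lemma square_left: "i \<in> I \<Longrightarrow> e i * (e i * x) = x"
  by (simp flip: mult.assoc add: square)

lemma anticommute_left: "i \<in> I \<Longrightarrow> j \<in> I \<Longrightarrow> i \<noteq> j \<Longrightarrow> e i * (e j * x) = - (e j * (e i * x))"
  by (metis anticommute minus_mult_left mult.assoc)

lemma card_flip: "finite S \<Longrightarrow> even (card (flip i S)) \<longleftrightarrow> odd (card S)"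
  by (auto simp: flip_def card_Diff_singleton_if card_gt_0_iff)

lemma flip_finsets: "i \<in> I \<Longrightarrow> S \<in> finsets \<Longrightarrow> flip i S \<in> finsets"
  by (auto simp: flip_def)

text \<open>
  Moving \<open>e i\<close> to its place in the increasing product only produces signs, and two equal neighbours
  cancel. This makes the monomials span the algebra.
\<close>

lemma gen_mult_monomial_cases:
  assumes "S \<in> finsets" "i \<in> I"
  shows "e i * monomial S = monomial (flip i S) \<or> e i * monomial S = - monomial (flip i S)"
proof -
  have "finite S" "S \<subseteq> I" using assms by auto
  then show ?thesis
  proof (induction rule: finite_linorder_min_induct)
    case empty
    show ?case using monomial_insert_min[of "{}" i] by (simp add: flip_def monomial_empty)
  next
    case (insert a S)
    have a: "a \<in> I" "a \<notin> S" using insert by auto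
    consider "i < a" | "i = a" | "a < i" by force
    then show ?case
    proof cases
      case 1
      then have "flip i (insert a S) = insert i (insert a S)" using insert.hyps by (auto simp: flip_def)
      moreover have "monomial (insert i (insert a S)) = e i * monomial (insert a S)"
        using insert.hyps 1 by (intro monomial_insert_min) auto
      ultimately show ?thesis by simp
    next
      case 2
      then have "flip i (insert a S) = S" using a by (auto simp: flip_def)
      then show ?thesis using insert 2 by (simp add: monomial_insert_min square_left assms)
    next
      case 3
      then have fl: "flip i (insert a S) = insert a (flip i S)" by (auto simp: flip_def)
      have "monomial (insert a (flip i S)) = e a * monomial (flip i S)"
        using insert.hyps 3 by (intro monomial_insert_min) (auto simp: flip_def)
      moreover have "e i * monomial (insert a S) = - (e a * (e i * monomial S))"
        using insert.hyps 3 a assms anticommute_left[of i a] by (simp add: monomial_insert_min)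
      ultimately show ?thesis using insert.IH insert.prems fl by auto
    qed
  qed
qed

text \<open>
  Prepending a new smallest factor \<open>e a\<close> introduces one more sign if \<open>i \<noteq> a\<close> and none if \<open>i = a\<close>,
  which is exactly how the commutation sign changes.
\<close>

lemma gen_mult_monomial:
  assumes "S \<in> finsets" "i \<in> I"
  shows "e i * monomial S = scaleA (sign i S) (monomial S * e i)"
proof -
  have "finite S" "S \<subseteq> I" using assms by auto
  then show ?thesis
  proof (induction rule: finite_linorder_min_induct)
    case empty
    then show ?case by (simp add: anticommutes_def monomial_empty)
  next
    case (insert a S)
    have a: "a \<in> I" "a \<notin> S" using insert by auto
    have IH: "e i * monomial S = scaleA (sign i S) (monomial S * e i)" using insert by simp
    have m: "monomial (insert a S) = e a * monomial S" using insert by (simp add: monomial_insert_min)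
    show ?case
    proof (cases "i = a")
      case True
      then have "sign i (insert a S) = sign i S"
        using a insert.hyps by (auto simp: anticommutes_def)
      moreover have "monomial (insert a S) * e i = scaleA (sign i S) (monomial S)"
        using IH True a by (simp add: m scale_mult_left mult.assoc square)
      ultimately show ?thesis using True a by (simp add: m square_left)
    next
      case False
      then have "sign i (insert a S) = - sign i S"
        using a insert.hyps by (auto simp: anticommutes_def)
      then show ?thesis using False IH a assms
        by (cases "anticommutes i S") (auto simp: m mult.assoc anticommute_left[of i a])
    qed
  qed
qed

lemma conj_monomial:
  assumes "S \<in> finsets" "i \<in> I"
  shows "e i * monomial S * e i = scaleA (sign i S) (monomial S)"
  using gen_mult_monomial[OF assms] by (simp add: scale_mult_left mult.assoc square assms)

lemma ad_monomial_gen: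
  assumes "S \<in> finsets" "i \<in> I"
  shows "ad (monomial S) (e i) = (if anticommutes i S then scaleA 2 (monomial S * e i) else 0)"
proof -
  have "scaleA 2 x = x + x" for x using scale_left_distrib[of 1 1 x] by simp
  then show ?thesis using gen_mult_monomial[OF assms] by (simp add: ad_def)
qed

lemma monomial_nonzero:
  assumes "S \<in> finsets" shows "monomial S \<noteq> 0"
proof -
  have "finite S" "S \<subseteq> I" using assms by auto
  then show ?thesis
  proof (induction rule: finite_linorder_min_induct)
    case (insert a S)
    then show ?case using square_left[of a "monomial S"] by (auto simp: monomial_insert_min)
  qed (simp add: monomial_empty)
qed

text \<open>
  For sets of the same parity any index in their symmetric difference works. For sets of different
  parity any index outside both works, and one exists because there are infinitely many generators.
\<close>

lemma finsets_separated:
  assumes "S \<in> finsets" "T \<in> finsets" "S \<noteq> T"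
  shows "\<exists>i\<in>I. anticommutes i S \<noteq> anticommutes i T"
proof (cases "even (card S) = even (card T)")
  case True
  then show ?thesis using assms by (auto simp: anticommutes_def)
next
  case False
  have "infinite (I - (S \<union> T))" using assms infinite_I by (simp add: Diff_infinite_finite)
  then obtain i where "i \<in> I - (S \<union> T)" by (metis finite.emptyI ex_in_conv)
  then show ?thesis using False by (auto simp: anticommutes_def)
qed

section \<open>The basis of monomials\<close>

text \<open>
  This is the independence of eigenvectors with different eigenvalues: for two terms \<open>S\<close> and \<open>T\<close>
  of a relation, conjugate by a generator that separates them and subtract the appropriate multiple
  of the relation. This removes \<open>T\<close>, but not \<open>S\<close>, and yields a shorter relation.
\<close>

lemma monomial_relation_trivial:
  assumes "finite F" "F \<subseteq> finsets" "(\<Sum>S\<in>F. scaleA (a S) (monomial S)) = 0" "S \<in> F"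
  shows "a S = 0"
  using assms
proof (induction "card F" arbitrary: F a S rule: less_induct)
  case less
  show ?case
  proof (cases "F = {S}")
    case True
    then show ?thesis using less.prems monomial_nonzero[of S] by auto
  next
    case False
    then obtain T where T: "T \<in> F" "T \<noteq> S" using less.prems by auto
    obtain i where i: "i \<in> I" "anticommutes i S \<noteq> anticommutes i T"
      using finsets_separated[of S T] T less.prems by blast
    define b where "b R = (sign i R - sign i T) * a R" for R
    have "0 = e i * (\<Sum>R\<in>F. scaleA (a R) (monomial R)) * e i
        - scaleA (sign i T) (\<Sum>R\<in>F. scaleA (a R) (monomial R))"
      using less.prems by simp
    also have "\<dots> = (\<Sum>R\<in>F. scaleA (a R) (e i * monomial R * e i))
        - (\<Sum>R\<in>F. scaleA (sign i T * a R) (monomial R))"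
      by (simp add: sum_distrib_left sum_distrib_right scale_mult_left scale_mult_right
          scale_sum_right sum_negf)
    also have "(\<Sum>R\<in>F. scaleA (a R) (e i * monomial R * e i))
        = (\<Sum>R\<in>F. scaleA (sign i R * a R) (monomial R))"
      using less.prems i by (intro sum.cong refl, subst conj_monomial) (auto simp: mult.commute)
    also have "(\<Sum>R\<in>F. scaleA (sign i R * a R) (monomial R))
        - (\<Sum>R\<in>F. scaleA (sign i T * a R) (monomial R)) = (\<Sum>R\<in>F. scaleA (b R) (monomial R))"
      unfolding sum_subtractf[symmetric] b_def
      by (simp only: left_diff_distrib scale_left_diff_distrib)
    also have "\<dots> = (\<Sum>R\<in>F - {T}. scaleA (b R) (monomial R))"
      using less.prems T by (subst sum.remove[of _ T]) (auto simp: b_def)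
    finally have "(\<Sum>R\<in>F - {T}. scaleA (b R) (monomial R)) = 0" by simp
    moreover have "card (F - {T}) < card F" using less.prems T by (intro card_Diff1_less)
    ultimately have "b S = 0"
      using less.prems T by (intro less.hyps[of "F - {T}" b S]) blast+
    then show ?thesis using i two_nonzero by (auto simp: b_def split: if_splits)
  qed
qed

lemma inj_on_monomial: "inj_on monomial finsets"
proof (rule inj_onI, rule ccontr)
  fix S T assume "S \<in> finsets" "T \<in> finsets" "monomial S = monomial T" "S \<noteq> T"
  then show False
    using monomial_relation_trivial[of "{S, T}" "\<lambda>R. if R = S then 1 else - 1" S] by auto
qed

lemma independent_monomial: "independent (monomial ` finsets)"
proof
  assume "dependent (monomial ` finsets)"
  then obtain F a where F: "finite F" "F \<subseteq> monomial ` finsets" "(\<Sum>x\<in>F. scaleA (a x) x) = 0"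
     "\<exists>x\<in>F. a x \<noteq> 0"
    by (auto simp: dependent_explicit)
  then obtain G where G: "G \<subseteq> finsets" "F = monomial ` G" by (meson subset_image_iff)
  have inj: "inj_on monomial G" using G inj_on_monomial inj_on_subset by blast
  then have "finite G" using F G finite_image_iff by blast
  moreover have "(\<Sum>S\<in>G. scaleA (a (monomial S)) (monomial S)) = 0"
    using F G inj by (simp add: sum.reindex)
  ultimately show False using monomial_relation_trivial[of G "a \<circ> monomial"] F(4) G by auto
qed

text \<open>
  Defined through the monomial basis, so that vanishing coordinates can be read off; the products of
  evenly or oddly many vectors are then shown to lie in it.
\<close>

definition parity_part :: "bool \<Rightarrow> 'a set" where
  "parity_part b = span (monomial ` {S\<in>finsets. even (card S) = b})"

lemma gen_mult_parity_part:
  assumes "x \<in> span (e ` I)" "y \<in> parity_part b"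
  shows "x * y \<in> parity_part (\<not> b)"
proof -
  have sub: "subspace (parity_part c)" for c by (simp add: parity_part_def)
  have "e i * y \<in> parity_part (\<not> b)" if "i \<in> I" for i
  proof -
    have "e i * monomial S \<in> parity_part (\<not> b)" if S: "S \<in> finsets" "even (card S) = b" for S
    proof -
      have "monomial (flip i S) \<in> parity_part (\<not> b)"
        unfolding parity_part_def
        using flip_finsets[OF \<open>i \<in> I\<close> S(1)] S card_flip[of S i]
        by (intro span_base imageI) auto
      then show ?thesis using gen_mult_monomial_cases[OF S(1) \<open>i \<in> I\<close>] sub subspace_neg by metis
    qed
    then have "monomial ` {S\<in>finsets. even (card S) = b} \<subseteq> {y. e i * y \<in> parity_part (\<not> b)}" by auto
    moreover have "subspace {y. e i * y \<in> parity_part (\<not> b)}"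
      using sub[of "\<not> b"] by (auto simp: subspace_def distrib_left scale_mult_right)
    ultimately show ?thesis
      using assms(2) span_minimal unfolding parity_part_def by blast
  qed
  then have "e ` I \<subseteq> {x. x * y \<in> parity_part (\<not> b)}" by auto
  moreover have "subspace {x. x * y \<in> parity_part (\<not> b)}"
    using sub[of "\<not> b"] by (auto simp: subspace_def distrib_right scale_mult_left)
  ultimately show ?thesis using assms(1) span_minimal by blast
qed

lemma prod_list_parity_part:
  "set xs \<subseteq> span (e ` I) \<Longrightarrow> prod_list xs \<in> parity_part (even (length xs))"
proof (induction xs)
  case Nil
  show ?case by (auto simp: parity_part_def monomial_empty intro!: span_base image_eqI[of _ _ "{}"])
next
  case (Cons x xs)
  then show ?case using gen_mult_parity_part[of x "prod_list xs"] by auto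
qed

lemma span_monomial: "span (monomial ` finsets) = UNIV"
proof -
  have "parity_part b \<subseteq> span (monomial ` finsets)" for b
    unfolding parity_part_def by (rule span_mono) auto
  then have "{prod_list xs | xs. set xs \<subseteq> span (e ` I)} \<subseteq> span (monomial ` finsets)"
    using prod_list_parity_part by blast
  then show ?thesis using generated span_minimal[OF _ subspace_span] by blast
qed

text \<open>Meaningful for \<open>S \<in> finsets\<close> only; the monomial of an infinite set is \<open>1\<close> by default.\<close>

definition coeff :: "'i set \<Rightarrow> 'a \<Rightarrow> 'f" where
  "coeff S x = representation (monomial ` finsets) x (monomial S)"

lemma linear_coeff: "Vector_Spaces.linear scaleA (*) (coeff S)"
proof -
  have "vector_space ((*) :: 'f \<Rightarrow> 'f \<Rightarrow> 'f)"
    by unfold_locales (simp_all add: algebra_simps)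
  moreover have "coeff S (x + y) = coeff S x + coeff S y" for x y
    unfolding coeff_def using representation_add[OF independent_monomial] span_monomial by simp
  moreover have "coeff S (scaleA c x) = c * coeff S x" for c x
    unfolding coeff_def using representation_scale[OF independent_monomial] span_monomial by simp
  ultimately show ?thesis
    using vector_space_axioms unfolding Vector_Spaces.linear_iff by blast
qed

lemma coeff_monomial: "S \<in> finsets \<Longrightarrow> T \<in> finsets \<Longrightarrow> coeff S (monomial T) = (if S = T then 1 else 0)"
  using inj_onD[OF inj_on_monomial, of S T]
  by (auto simp: coeff_def representation_basis[OF independent_monomial])

lemma coeff_parity_part:
  assumes "x \<in> parity_part b" "S \<in> finsets" "even (card S) \<noteq> b"
  shows "coeff S x = 0"
proof -
  interpret c: Vector_Spaces.linear scaleA "(*)" "coeff S" by (rule linear_coeff)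
  have "parity_part b \<subseteq> {x. coeff S x = 0}"
    unfolding parity_part_def using assms
    by (intro span_minimal c.subspace_kernel) (auto simp: coeff_monomial split: if_splits)
  then show ?thesis using assms by auto
qed

lemma coeff_expansion:
  "finite {S\<in>finsets. coeff S x \<noteq> 0}"
  "x = (\<Sum>S\<in>{S\<in>finsets. coeff S x \<noteq> 0}. scaleA (coeff S x) (monomial S))"
proof -
  let ?r = "representation (monomial ` finsets) x"
  let ?A = "{S\<in>finsets. coeff S x \<noteq> 0}"
  have im: "monomial ` ?A = {b. ?r b \<noteq> 0}"
    using representation_ne_zero[of "monomial ` finsets" x] by (auto simp: coeff_def)
  have inj: "inj_on monomial ?A" by (rule inj_on_subset[OF inj_on_monomial]) auto
  show "finite ?A"
    using finite_representation[of "monomial ` finsets" x] finite_imageD[OF _ inj] im by simp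
  have "x = (\<Sum>b\<in>monomial ` ?A. scaleA (?r b) b)"
    using sum_nonzero_representation_eq[OF independent_monomial, of x] span_monomial im by simp
  also have "\<dots> = (\<Sum>S\<in>?A. scaleA (coeff S x) (monomial S))"
    by (subst sum.reindex[OF inj]) (simp add: coeff_def)
  finally show "x = (\<Sum>S\<in>?A. scaleA (coeff S x) (monomial S))" .
qed

text \<open>
  Conjugation by a generator is diagonal in the monomial basis, so it acts on coordinates by signs.
\<close>

lemma coeff_conj:
  assumes "S \<in> finsets" "i \<in> I"
  shows "coeff S (e i * x * e i) = sign i S * coeff S x"
proof -
  interpret c: Vector_Spaces.linear scaleA "(*)" "coeff S" by (rule linear_coeff)
  have "monomial ` finsets \<subseteq> {x. coeff S (e i * x * e i) = sign i S * coeff S x}"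
    using assms by (auto simp: conj_monomial c.scale c.neg coeff_monomial)
  moreover have "subspace {x. coeff S (e i * x * e i) = sign i S * coeff S x}"
    by (rule subspaceI)
      (auto simp: distrib_left distrib_right c.add scale_mult_left scale_mult_right c.scale)
  ultimately have "span (monomial ` finsets) \<subseteq> {x. coeff S (e i * x * e i) = sign i S * coeff S x}"
    by (rule span_minimal)
  then show ?thesis using span_monomial by auto
qed

section \<open>Representing derivations\<close>

text \<open>
  A parity-free version of the even and odd representations. The requirement that each index occurs
  finitely or cofinitely often is a consequence of the pointwise finiteness of the sum, see
  \<open>ad_representation_finite\<close>. The empty set has to be excluded because its inner derivation is zero,
  so its coefficient would be arbitrary.
\<close>

definition ad_representation :: "('a \<Rightarrow> 'a) \<Rightarrow> ('i set \<Rightarrow> 'f) \<Rightarrow> bool" where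
  "ad_representation D \<alpha> \<longleftrightarrow>
     (\<forall>S. \<alpha> S \<noteq> 0 \<longrightarrow> S \<in> finsets \<and> S \<noteq> {}) \<and> is_ad_sum scaleA monomial {S. \<alpha> S \<noteq> 0} \<alpha> D"

lemma ad_monomial_gen_nonzero:
  assumes "S \<in> finsets" "i \<in> I"
  shows "ad (monomial S) (e i) \<noteq> 0 \<longleftrightarrow> anticommutes i S"
proof -
  have "monomial S * e i \<noteq> 0"
    using monomial_nonzero[OF assms(1)] square[OF assms(2)]
    by (metis mult.assoc mult_zero_left mult.right_neutral)
  then show ?thesis using two_nonzero assms by (simp add: ad_monomial_gen)
qed

text \<open>The terms that are nonzero at \<open>e i\<close> are exactly those that anticommute with it.\<close>

lemma ad_representation_finite:
  assumes "ad_representation D \<alpha>" "i \<in> I"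
  shows "finite {S. \<alpha> S \<noteq> 0 \<and> anticommutes i S}"
proof -
  have "{S. \<alpha> S \<noteq> 0 \<and> anticommutes i S} = {S\<in>{S. \<alpha> S \<noteq> 0}. ad (monomial S) (e i) \<noteq> 0}"
    using assms ad_monomial_gen_nonzero unfolding ad_representation_def by blast
  then show ?thesis using assms by (simp add: ad_representation_def is_ad_sum_def)
qed

text \<open>
  The terms that survive at \<open>e i\<close> contribute \<open>2 * \<alpha> S\<close> times the monomial of \<open>S\<close> times \<open>e i\<close>, so
  multiplication by \<open>e i\<close> from the right displays the coefficients in the monomial basis.
\<close>

lemma ad_representation_coeff:
  assumes rep: "ad_representation D \<alpha>" and S: "S \<in> finsets" and i: "i \<in> I" "anticommutes i S"
  shows "\<alpha> S = coeff S (D (e i) * e i) / 2"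
proof -
  interpret c: Vector_Spaces.linear scaleA "(*)" "coeff S" by (rule linear_coeff)
  let ?F = "{S. \<alpha> S \<noteq> 0 \<and> anticommutes i S}"
  have F: "?F \<subseteq> finsets" using rep by (auto simp: ad_representation_def)
  have "?F = {S\<in>{S. \<alpha> S \<noteq> 0}. ad (monomial S) (e i) \<noteq> 0}"
    using rep ad_monomial_gen_nonzero[OF _ i(1)] unfolding ad_representation_def by blast
  then have "D (e i) = (\<Sum>T\<in>?F. scaleA (\<alpha> T) (ad (monomial T) (e i)))"
    using rep by (simp add: ad_representation_def is_ad_sum_def)
  also have "\<dots> = (\<Sum>T\<in>?F. scaleA (\<alpha> T * 2) (monomial T * e i))"
    using F i by (intro sum.cong) (auto simp: ad_monomial_gen)
  finally have "D (e i) * e i = (\<Sum>T\<in>?F. scaleA (\<alpha> T * 2) (monomial T))"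
    by (simp add: sum_distrib_right scale_mult_left mult.assoc square i)
  then have "coeff S (D (e i) * e i) = (\<Sum>T\<in>?F. \<alpha> T * 2 * coeff S (monomial T))"
    by (simp add: c.sum c.scale)
  also have "\<dots> = (\<Sum>T\<in>?F. if T = S then \<alpha> S * 2 else 0)"
  proof (rule sum.cong[OF refl])
    fix T assume "T \<in> ?F"
    then have "T \<in> finsets" using F by blast
    then show "\<alpha> T * 2 * coeff S (monomial T) = (if T = S then \<alpha> S * 2 else 0)"
      by (simp add: coeff_monomial[OF S])
  qed
  also have "\<dots> = \<alpha> S * 2"
    using i ad_representation_finite[OF rep i(1)] by (auto simp: sum.delta)
  finally show ?thesis using two_nonzero by simp
qed

lemma ex_anticommutes:
  assumes "S \<in> finsets" "S \<noteq> {}"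
  shows "\<exists>i\<in>I. anticommutes i S"
  using finsets_separated[of S "{}"] assms by (auto simp: anticommutes_def)

lemma ad_representation_unique:
  assumes "ad_representation D \<alpha>" "ad_representation D \<beta>"
  shows "\<alpha> = \<beta>"
proof
  fix S
  show "\<alpha> S = \<beta> S"
  proof (cases "S \<in> finsets \<and> S \<noteq> {}")
    case True
    then obtain i where i: "i \<in> I" "anticommutes i S" using ex_anticommutes by blast
    then show ?thesis
      using True ad_representation_coeff[OF assms(1) _ i] ad_representation_coeff[OF assms(2) _ i]
      by (simp only:)
  next
    case False
    then have "\<alpha> S = 0" "\<beta> S = 0" using assms unfolding ad_representation_def by blast+
    then show ?thesis by simp
  qed
qed

text \<open>
  This is what \<open>D (e i * e j + e j * e i) = 0\<close> means in coordinates. If both generators anticommute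
  with the monomial of \<open>S\<close>, both sign factors are \<open>2\<close>, so the coefficient at \<open>S\<close> is independent
  of the generator from which it is read off.
\<close>

lemma derivation_coeff:
  assumes D: "derivation scaleA D" and S: "S \<in> finsets" and ij: "i \<in> I" "j \<in> I"
  shows "(1 - sign j S) * coeff S (D (e i) * e i) = (1 - sign i S) * coeff S (D (e j) * e j)"
proof (cases "i = j")
  case False
  interpret D: Vector_Spaces.linear scaleA scaleA D using D by (simp add: derivation_def)
  interpret c: Vector_Spaces.linear scaleA "(*)" "coeff S" by (rule linear_coeff)
  have Dmult: "D (x * y) = D x * y + x * D y" for x y
    using D by (simp add: derivation_def)
  define x y where "x = D (e i) * e i" and "y = D (e j) * e j"
  have xy: "D (e i) = x * e i" "D (e j) = y * e j"
    by (simp_all add: x_def y_def mult.assoc square ij)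
  \<comment> \<open>Multiplying the derivative of the anticommutation relation by \<open>e j * e i\<close> leaves only \<open>x\<close>, \<open>y\<close>
    and their conjugates, on which coordinates are controlled.\<close>
  have "0 = D (e i * e j + e j * e i)" using ij False by (simp add: anticommute[of i j])
  also have "\<dots> = x * (e i * e j) + e i * y * e j + y * (e j * e i) + e j * x * e i"
    unfolding D.add Dmult xy by (simp add: mult.assoc)
  finally have "0 = (x * (e i * e j) + e i * y * e j + y * (e j * e i) + e j * x * e i) * (e j * e i)"
    by simp
  also have "\<dots> = x * (e i * (e j * (e j * e i))) + e i * y * (e j * (e j * e i))
     + y * (e j * (e i * (e j * e i))) + e j * x * (e i * (e j * e i))"
    by (simp add: distrib_right mult.assoc)
  also have "\<dots> = x + e i * y * e i - y - e j * x * e j"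
    using ij False anticommute_left[of i j "e i"]
    by (simp add: square square_left mult.assoc)
  finally have "coeff S (x + e i * y * e i - y - e j * x * e j) = coeff S 0" by simp
  then have "coeff S x + sign i S * coeff S y - coeff S y - sign j S * coeff S x = 0"
    unfolding c.add c.diff c.zero using ij S by (simp only: coeff_conj)
  then show ?thesis unfolding x_def y_def by (simp add: algebra_simps)
qed simp

text \<open>
  Differentiating \<open>e i * e i = 1\<close> shows that \<open>D (e i) * e i\<close> is negated by conjugation with \<open>e i\<close>;
  monomials that are fixed by this conjugation therefore do not occur in it.
\<close>

lemma derivation_coeff_commuting:
  assumes D: "derivation scaleA D" and S: "S \<in> finsets" and i: "i \<in> I" "\<not> anticommutes i S"
  shows "coeff S (D (e i) * e i) = 0"
proof -
  interpret D: Vector_Spaces.linear scaleA scaleA D using D by (simp add: derivation_def)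
  interpret c: Vector_Spaces.linear scaleA "(*)" "coeff S" by (rule linear_coeff)
  have Dmult: "D (x * y) = D x * y + x * D y" for x y
    using D by (simp add: derivation_def)
  have "D 1 = 0" using Dmult[of 1 1] by simp
  then have "D (e i) * e i + e i * D (e i) = 0" using Dmult[of "e i" "e i"] i by (simp add: square)
  then have "D (e i) * e i + e i * (D (e i) * e i) * e i = 0"
    using i by (simp add: mult.assoc square)
  then have "coeff S (D (e i) * e i) + sign i S * coeff S (D (e i) * e i) = 0"
    using coeff_conj[OF S i(1)] c.add c.zero by metis
  then have "2 * coeff S (D (e i) * e i) = 0" using i by simp
  then show ?thesis using two_nonzero by (metis mult_eq_0_iff)
qed

text \<open>
  The sum is correct at \<open>e i\<close> because \<open>D (e i) = (D (e i) * e i) * e i\<close>, and on the monomials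
  occurring in the first factor, right multiplication by \<open>2 * e i\<close> is the commutator with \<open>e i\<close>.
\<close>

theorem ad_representation_exists:
  assumes D: "derivation scaleA D"
  shows "\<exists>\<alpha>. ad_representation D \<alpha>"
proof -
  define \<alpha> where "\<alpha> S = (if S \<in> finsets \<and> S \<noteq> {}
      then let k = SOME i. i \<in> I \<and> anticommutes i S in coeff S (D (e k) * e k) / 2
      else 0)" for S
  have \<alpha>: "2 * \<alpha> S = coeff S (D (e i) * e i)" if "S \<in> finsets" "i \<in> I" "anticommutes i S" for S i
  proof -
    define k where "k = (SOME i. i \<in> I \<and> anticommutes i S)"
    have k: "k \<in> I \<and> anticommutes k S" unfolding k_def by (rule someI[of _ i]) (use that in auto)
    have "S \<noteq> {}" using that by (auto simp: anticommutes_def)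
    then have "2 * \<alpha> S = coeff S (D (e k) * e k)"
      using that two_nonzero by (simp add: \<alpha>_def Let_def flip: k_def)
    then show ?thesis using derivation_coeff[OF D that(1,2), of k] k that two_nonzero by simp
  qed
  have supp: "S \<in> finsets \<and> S \<noteq> {}" if "\<alpha> S \<noteq> 0" for S
    using that unfolding \<alpha>_def by (metis (lifting))
  have set_eq: "{S\<in>{S. \<alpha> S \<noteq> 0}. ad (monomial S) (e i) \<noteq> 0} = {S\<in>finsets. coeff S (D (e i) * e i) \<noteq> 0}"
    if "i \<in> I" for i
  proof (rule Collect_cong, unfold mem_Collect_eq)
    fix S
    consider "S \<notin> finsets" | "S \<in> finsets" "anticommutes i S" | "S \<in> finsets" "\<not> anticommutes i S" by blast
    then show "(\<alpha> S \<noteq> 0 \<and> ad (monomial S) (e i) \<noteq> 0) = ((finite S \<and> S \<subseteq> I) \<and> coeff S (D (e i) * e i) \<noteq> 0)"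
    proof cases
      case 1 then show ?thesis using supp[of S] by auto
    next
      case 2 then show ?thesis
        using \<alpha>[OF 2(1) that 2(2)] ad_monomial_gen_nonzero[OF 2(1) that] two_nonzero by auto
    next
      case 3 then show ?thesis
        using derivation_coeff_commuting[OF D 3(1) that 3(2)] ad_monomial_gen_nonzero[OF 3(1) that] by auto
    qed
  qed
  have "is_ad_sum scaleA monomial {S. \<alpha> S \<noteq> 0} \<alpha> D"
  proof (rule is_ad_sum_if_on_generators[OF D generated])
    fix a assume "a \<in> e ` I"
    then obtain i where i: "i \<in> I" "a = e i" by auto
    let ?F = "{S\<in>finsets. coeff S (D (e i) * e i) \<noteq> 0}"
    show "finite {S\<in>{S. \<alpha> S \<noteq> 0}. ad (monomial S) a \<noteq> 0}"
      unfolding i set_eq[OF i(1)] by (rule coeff_expansion)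
    have "D (e i) = D (e i) * e i * e i" using i by (simp add: mult.assoc square)
    also have "\<dots> = (\<Sum>S\<in>?F. scaleA (coeff S (D (e i) * e i)) (monomial S)) * e i"
      using coeff_expansion(2)[of "D (e i) * e i"] by simp
    also have "\<dots> = (\<Sum>S\<in>?F. scaleA (\<alpha> S) (ad (monomial S) (e i)))"
      unfolding sum_distrib_right
    proof (rule sum.cong[OF refl])
      fix S assume S: "S \<in> ?F"
      then have "anticommutes i S" using derivation_coeff_commuting[OF D _ i(1)] by blast
      then show "scaleA (coeff S (D (e i) * e i)) (monomial S) * e i = scaleA (\<alpha> S) (ad (monomial S) (e i))"
        using S i \<alpha>[of S i] by (simp add: ad_monomial_gen scale_mult_left mult.commute)
    qed
    finally show "D a = (\<Sum>S\<in>{S\<in>{S. \<alpha> S \<noteq> 0}. ad (monomial S) a \<noteq> 0}. scaleA (\<alpha> S) (ad (monomial S) a))"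
      unfolding i set_eq[OF i(1)] .
  qed
  then show ?thesis using supp unfolding ad_representation_def by blast
qed

lemma ad_representation_parity:
  assumes rep: "ad_representation D \<alpha>" and D: "\<And>i. i \<in> I \<Longrightarrow> D (e i) \<in> parity_part (\<not> b)"
    and S: "\<alpha> S \<noteq> 0"
  shows "even (card S) = b"
proof (rule ccontr)
  assume par: "even (card S) \<noteq> b"
  have fin: "S \<in> finsets" "S \<noteq> {}" using rep S by (auto simp: ad_representation_def)
  then obtain i where i: "i \<in> I" "anticommutes i S" using ex_anticommutes by blast
  \<comment> \<open>Only left multiplication by generators is available on the parity parts, so parity is tested
    on the conjugate of \<open>D (e i) * e i\<close>, which has the same coordinates up to sign.\<close>
  have "e i * (D (e i) * e i) * e i \<in> parity_part b"
    using gen_mult_parity_part[OF span_base[OF imageI[OF i(1)]] D[OF i(1)]] i(1)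
    by (simp add: mult.assoc square)
  then have "coeff S (e i * (D (e i) * e i) * e i) = 0"
    using coeff_parity_part fin par by blast
  then have "coeff S (D (e i) * e i) = 0"
    using coeff_conj[OF fin(1) i(1)] by (simp split: if_splits)
  then show False using ad_representation_coeff[OF rep fin(1) i] S by simp
qed

text \<open>
  Generators are odd, so the hypothesis \<open>par\<close> holds for even derivations with \<open>b = True\<close> and for
  odd ones with \<open>b = False\<close>.
\<close>

theorem homogeneous_ad_representation_ex1:
  assumes D: "derivation scaleA D" and par: "\<And>i. i \<in> I \<Longrightarrow> D (e i) \<in> parity_part (\<not> b)"
  shows "\<exists>!\<alpha>. ad_representation D \<alpha> \<and> (\<forall>S. \<alpha> S \<noteq> 0 \<longrightarrow> even (card S) = b)"
proof -
  obtain \<alpha> where \<alpha>: "ad_representation D \<alpha>" using ad_representation_exists[OF D] by blast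
  have "even (card S) = b" if "\<alpha> S \<noteq> 0" for S
    by (rule ad_representation_parity[OF \<alpha> par that])
  then show ?thesis using \<alpha> ad_representation_unique by blast
qed

end

section \<open>Derivations of the Clifford algebra\<close>

theorem theorem2:
  fixes scaleV :: "'f::alg_closed_field \<Rightarrow> 'v::ab_group_add \<Rightarrow> 'v"
    and scaleA :: "'f \<Rightarrow> 'a::ring_1 \<Rightarrow> 'a"
    and f :: "'v \<Rightarrow> 'f" and \<iota> :: "'v \<Rightarrow> 'a" and v :: "nat \<Rightarrow> 'v"
  assumes "CHAR('f) \<noteq> 2"
    and "vector_space scaleV"
    and "countably_infinite_dimensional scaleV"
    and "quadratic_form scaleV f"
    and "nondegenerate f"
    and "clifford_algebra scaleV scaleA f \<iota>"
    and "orthonormal_basis scaleV \<iota> v"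
  shows "(\<forall>D. derivation scaleA D \<and> even_map scaleA \<iota> D \<and> D \<noteq> (\<lambda>_. 0) \<longrightarrow>
             (\<exists>!\<alpha>. even_ad_representation scaleA \<iota> v D \<alpha>)) \<and>
         (\<forall>D. derivation scaleA D \<and> odd_map scaleA \<iota> D \<and> D \<noteq> (\<lambda>_. 0) \<longrightarrow>
             (\<exists>!\<alpha>. odd_ad_representation scaleA \<iota> v D \<alpha>))"
proof -
  interpret C: clifford_algebra scaleV scaleA f \<iota> by fact
  interpret \<iota>: Vector_Spaces.linear scaleV scaleA \<iota> by (rule C.linear_iota)
  let ?e = "\<lambda>i. \<iota> (v i)" and ?I = "{1..} :: nat set"
  have two: "(2::'f) \<noteq> 0"
  proof
    assume "(2::'f) = 0"
    then have "of_nat 2 = (0::'f)" by simp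
    then have "CHAR('f) dvd 2" by (simp only: of_nat_eq_0_iff_char_dvd)
    then show False
      using assms(1) CHAR_not_1' [where ?'a='f] by (metis prime_nat_iff two_is_prime_nat One_nat_def)
  qed
  have rel: "?e i * ?e j + ?e j * ?e i = (if i = j then 2 else 0)" if "i \<in> ?I" "j \<in> ?I" for i j
    using assms(7) that by (auto simp: orthonormal_basis_def)
  have dbl: "scaleA 2 x = x + x" for x using C.A.scale_left_distrib[of 1 1 x] by simp
  have span_e: "\<iota> x \<in> C.A.span (?e ` ?I)" for x
  proof -
    have "x \<in> C.V.span (v ` ?I)" using assms(7) by (auto simp: orthonormal_basis_def is_basis_def)
    then have "\<iota> x \<in> C.A.span (\<iota> ` v ` ?I)" by (simp only: \<iota>.span_image imageI)
    then show ?thesis by (simp add: image_image)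
  qed
  interpret G: clifford_generators scaleA ?e ?I
  proof
    show "infinite ?I" by (rule infinite_Ici)
    show "?e i * ?e i = 1" if "i \<in> ?I" for i
    proof -
      have "scaleA 2 (?e i * ?e i) = scaleA 2 1" using rel[OF that that] by (simp add: dbl)
      then show ?thesis using two by simp
    qed
    show "?e i * ?e j = - (?e j * ?e i)" if "i \<in> ?I" "j \<in> ?I" "i \<noteq> j" for i j
      using rel[OF that(1,2)] that(3) by (simp add: eq_neg_iff_add_eq_0)
    show "C.A.span {prod_list xs | xs. set xs \<subseteq> C.A.span (?e ` ?I)} = UNIV" (is "C.A.span ?P = _")
    proof -
      have "prod_list (map \<iota> w) \<in> C.A.span ?P" for w
        using span_e by (intro C.A.span_base CollectI exI[of _ "map \<iota> w"]) auto
      then have "free_eval scaleA \<iota> p \<in> C.A.span ?P" for p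
        unfolding free_eval_def by (simp only: C.A.span_sum C.A.span_scale)
      then have "range (free_eval scaleA \<iota>) \<subseteq> C.A.span ?P" by blast
      then show ?thesis by (simp only: C.generated top.extremum_unique)
    qed
  qed (fact two)
  have monomial: "G.monomial = basis_product \<iota> v"
    by (simp add: fun_eq_iff G.monomial_def basis_product_def)
  have words: "prod_list (map \<iota> w) \<in> G.parity_part (even (length w))" for w
    using G.prod_list_parity_part[of "map \<iota> w"] span_e by (simp add: image_subset_iff)
  have even_part: "clifford_even scaleA \<iota> \<subseteq> G.parity_part True"
  proof -
    have "insert 1 {prod_list (map \<iota> w) | w. even (length w)} \<subseteq> G.parity_part True"
      using words words[of "[]"] by auto metis
    then show ?thesis unfolding clifford_even_def G.parity_part_def
      by (rule C.A.span_minimal[OF _ C.A.subspace_span])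
  qed
  have odd_part: "clifford_odd scaleA \<iota> \<subseteq> G.parity_part False"
  proof -
    have "{prod_list (map \<iota> w) | w. odd (length w)} \<subseteq> G.parity_part False"
      using words by auto metis
    then show ?thesis unfolding clifford_odd_def G.parity_part_def
      by (rule C.A.span_minimal[OF _ C.A.subspace_span])
  qed
  have gen_odd: "?e i \<in> clifford_odd scaleA \<iota>" for i
    unfolding clifford_odd_def
    by (rule C.A.span_base) (auto intro!: exI[of _ "[v i]"])
  have rep_iff: "G.ad_representation D \<alpha> \<longleftrightarrow>
      (\<forall>S. \<alpha> S \<noteq> 0 \<longrightarrow> (finite S \<and> S \<subseteq> {1..}) \<and> S \<noteq> {}) \<and>
      is_ad_sum scaleA (basis_product \<iota> v) {S. \<alpha> S \<noteq> 0} \<alpha> D" for D \<alpha>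
    by (simp only: G.ad_representation_def monomial mem_Collect_eq)
  have even_iff: "even_ad_representation scaleA \<iota> v D \<alpha> \<longleftrightarrow>
      G.ad_representation D \<alpha> \<and> (\<forall>S. \<alpha> S \<noteq> 0 \<longrightarrow> even (card S))" (is "?L \<longleftrightarrow> ?R") for D \<alpha>
  proof
    assume ?L
    then show ?R unfolding even_ad_representation_def Let_def rep_iff by auto
  next
    assume R: ?R
    then have "finite {S\<in>{S. \<alpha> S \<noteq> 0}. i \<in> S}" if "i \<ge> 1" for i
    proof -
      have "{S\<in>{S. \<alpha> S \<noteq> 0}. i \<in> S} = {S. \<alpha> S \<noteq> 0 \<and> G.anticommutes i S}"
        using R by (auto simp: G.anticommutes_def)
      then show ?thesis using R G.ad_representation_finite[of D \<alpha> i] that by simp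
    qed
    then show ?L using R unfolding even_ad_representation_def Let_def rep_iff by auto
  qed
  have odd_iff: "odd_ad_representation scaleA \<iota> v D \<alpha> \<longleftrightarrow>
      G.ad_representation D \<alpha> \<and> (\<forall>S. \<alpha> S \<noteq> 0 \<longrightarrow> odd (card S))" (is "?L \<longleftrightarrow> ?R") for D \<alpha>
  proof
    assume ?L
    then show ?R unfolding odd_ad_representation_def Let_def rep_iff by auto
  next
    assume R: ?R
    then have "finite {S\<in>{S. \<alpha> S \<noteq> 0}. i \<notin> S}" if "i \<ge> 1" for i
    proof -
      have "{S\<in>{S. \<alpha> S \<noteq> 0}. i \<notin> S} = {S. \<alpha> S \<noteq> 0 \<and> G.anticommutes i S}"
        using R by (auto simp: G.anticommutes_def)
      then show ?thesis using R G.ad_representation_finite[of D \<alpha> i] that by simp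
    qed
    then show ?L using R unfolding odd_ad_representation_def Let_def rep_iff by auto
  qed
  show ?thesis
  proof (intro conjI allI impI; elim conjE)
    fix D assume D: "derivation scaleA D" "even_map scaleA \<iota> D"
    have "D (?e i) \<in> G.parity_part (\<not> True)" for i
      using D(2) gen_odd[of i] odd_part by (auto simp: even_map_def)
    then show "\<exists>!\<alpha>. even_ad_representation scaleA \<iota> v D \<alpha>"
      using G.homogeneous_ad_representation_ex1[OF D(1), of True] unfolding even_iff by simp
  next
    fix D assume D: "derivation scaleA D" "odd_map scaleA \<iota> D"
    have "D (?e i) \<in> G.parity_part (\<not> False)" for i
      using D(2) gen_odd[of i] even_part by (auto simp: odd_map_def)
    then show "\<exists>!\<alpha>. odd_ad_representation scaleA \<iota> v D \<alpha>"
      using G.homogeneous_ad_representation_ex1[OF D(1), of False] unfolding odd_iff by simp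
  qed
qed

end
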